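(* Let $\pmb k$ be a field and $d=2c$ a positive even integer, and let $\pmb d_2^{(1)},\pmb d_2^{(2)},\pmb d_2^{(3)}$ be the $3\times2$ matrices with entries in $\pmb k[\pmb z,x,y]$ defined in the context. Then there exists an open cover $\operatorname{Bal}_d^{(1)}\cup\operatorname{Bal}_d^{(2)}\cup\operatorname{Bal}_d^{(3)}$ of $\operatorname{Bal}_d$ such that if $\pmb g=(g_1,g_2,g_3)\in\operatorname{Bal}_d^{(j)}$, then $\pmb d_2^{(j)}|_{\lambda_{\pmb g}}$ is a Hilbert-Burch matrix for the row vector $\pmb d_1(\pmb g)=[g_1,g_2,g_3]$.
   Context: $B=\pmb k[x,y]$ is the standard graded polynomial ring; $\mathbb A_d=B_d\times B_d\times B_d$ is the space of ordered triples of forms of degree $d$. If $\pmb g=(g_1,g_2,g_3)\in\mathbb A_d$ with $g_j=\sum_{i=0}^d\lambda_{i,j}x^iy^{d-i}$, then $\lambda_{\pmb g}=(\lambda_{i,j})\in\mathbb A^{3d+3}$; this identifies $\mathbb A_d$ with $\mathbb A^{3d+3}$ (Zariski topology). $\pmb z=(z_{i,j})$, $0\le i\le d$, $1\le j\le3$, are indeterminates (coordinates on $\mathbb A^{3d+3}$), and for a matrix $M$ over $\pmb k[\pmb z,x,y]$, $M|_{\lambda}$ is the matrix over $B$ obtained by substituting $z_{i,j}=\lambda_{i,j}$. A Hilbert-Burch matrix for $[g_1,g_2,g_3]$, where $(g_1,g_2,g_3)B$ has height two, is a $3\times2$ matrix $\varphi$ such that $0\to B^2\xrightarrow{\varphi}B^3\xrightarrow{[g_1,g_2,g_3]}B$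 is exact. $\operatorname{Bal}_d$ is the set of $\pmb g\in\mathbb A_d$ such that every entry in a homogeneous Hilbert-Burch matrix for $[g_1,g_2,g_3]$ has degree $d/2=c$. Definition of $\pmb d_2^{(j)}$. Let $A=[A_1|A_2|A_3]$ be the $(3c+1)\times(3c+3)$ matrix where the block $A_j$ has rows indexed by $r=0,\dots,3c$, columns indexed by $k=0,\dots,c$, and $(r,k)$ entry $z_{r-k,j}$ (zero unless $0\le r-k\le d$). Number the columns of $A$ by $1,\dots,3c+3$ and let $A(i,m)$, for $i<m$, be the determinant of the submatrix of $A$ obtained by deleting columns $i$ and $m$. For $i\in\{1,c+2,2c+3\}$ let $\pmb b^{(i)}$ be the column vector with entries $b^{(i)}_m$, $1\le m\le3c+3$, given by $$b^{(i)}_m=(-1)^{m+1}A(m,i)\ (m<i),\qquad b^{(i)}_i=0,\qquad b^{(i)}_m=(-1)^mA(i,m)\ (m>i).$$ Let $\rho^{(c)}=[y^c,xy^{c-1},\dots,x^c]$ and let $N^{(c)}$ be the $3\times3(c+1)$ block diagonal matrix with three diagonal blocks equal to $\rho^{(c)}$. Put $\pmb q_1=N^{(c)}\pmb b^{(1)}$, $\pmb q_2=N^{(c)}\pmb b^{(c+2)}$, $\pmb q_3=N^{(c)}\pmb b^{(2c+3)}$, and $\pmb d_2=[\pmb q_1,\pmb q_2,\pmb q_3]$. For $1\le j\le3$, $\pmb d_2^{(j)}$ is $\pmb d_2$ with column $j$ removed. *)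

theory Defs
  imports
    "HOL-Analysis.Abstract_Topology"
    "HOL-Library.Poly_Mapping"
    "HOL-Library.Extended_Nat"
    "HOL-Algebra.Algebraic_Closure_Type"
    "Jordan_Normal_Form.Determinant"
    "Jordan_Normal_Form.Matrix_Kernel"
    "Jordan_Normal_Form.DL_Submatrix"
begin

text \<open>The height of an ideal in the sense of Krull: for a prime ideal, the supremum of the lengths
  of the chains of prime ideals descending from it; for an arbitrary ideal, the infimum of the
  heights of the primes containing it (so the unit ideal has height \<open>\<infinity>\<close>).\<close>

definition prime_height :: "('b, 'm) ring_scheme \<Rightarrow> 'b set \<Rightarrow> enat" where
  "prime_height R P = Sup {enat n | n. \<exists>C :: nat \<Rightarrow> 'b set.
      (\<forall>i\<le>n. primeideal (C i) R) \<and> (\<forall>i<n. C i \<subset> C (Suc i)) \<and> C n = P}"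

definition ideal_height :: "('b, 'm) ring_scheme \<Rightarrow> 'b set \<Rightarrow> enat" where
  "ideal_height R I = Inf {prime_height R P | P. primeideal P R \<and> I \<subseteq> P}"


text \<open>\<open>R[x,y]\<close> is represented as \<open>R[x][y]\<close>: the coefficient of \<open>x^i y^j\<close> in \<open>p\<close> is
  \<open>coeff (coeff p j) i\<close>.\<close>

definition varx :: "'b::comm_semiring_1 poly poly" where
  "varx = [:[:0, 1:]:]"

definition vary :: "'b::comm_semiring_1 poly poly" where
  "vary = [:0, 1:]"

definition forms :: "nat \<Rightarrow> 'a::zero poly poly set" where
  "forms e = {p. \<forall>i j. Polynomial.coeff (Polynomial.coeff p j) i \<noteq> 0 \<longrightarrow> i + j = e}"

definition form_triples :: "nat \<Rightarrow> 'a::zero poly poly vec set" where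
  "form_triples d = {g \<in> carrier_vec 3. \<forall>j<3. g $ j \<in> forms d}"

definition d1 :: "'b vec \<Rightarrow> 'b mat" where
  "d1 g = mat_of_rows 3 [g]"

text \<open>The first kernel condition is exactness at \<open>B\<^sup>2\<close>, the second one exactness at \<open>B\<^sup>3\<close>.\<close>

definition hilbert_burch :: "'a::field poly poly mat \<Rightarrow> 'a poly poly mat \<Rightarrow> bool" where
  "hilbert_burch G \<phi> \<longleftrightarrow>
     G \<in> carrier_mat 1 3 \<and>
     ideal_height ring_of_type_algebra (Idl\<^bsub>ring_of_type_algebra\<^esub> (elements_mat G)) = 2 \<and>
     \<phi> \<in> carrier_mat 3 2 \<and>
     mat_kernel \<phi> = {0\<^sub>v 2} \<and>
     mat_kernel G = (\<lambda>v. \<phi> *\<^sub>v v) ` carrier_vec 2"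

text \<open>The three entries of \<open>G\<close> are forms of one common degree, so homogeneity of \<open>\<phi>\<close> means that the
  entries of each column are forms of a common degree. Zero is a form of every degree.\<close>

definition homogeneous_hilbert_burch :: "'a::field poly poly mat \<Rightarrow> 'a poly poly mat \<Rightarrow> bool" where
  "homogeneous_hilbert_burch G \<phi> \<longleftrightarrow>
     hilbert_burch G \<phi> \<and> (\<forall>l<2. \<exists>e. \<forall>i<3. \<phi> $$ (i, l) \<in> forms e)"

definition Bal :: "nat \<Rightarrow> 'a::field poly poly vec set" where
  "Bal d = {g \<in> form_triples d. \<exists>\<phi>. homogeneous_hilbert_burch (d1 g) \<phi> \<and>
      (\<forall>i<3. \<forall>l<2. \<phi> $$ (i, l) \<in> forms (d div 2))}"


text \<open>Polynomials in the indeterminates \<open>z\<^bsub>i,j\<^esub>\<close>, indexed by the pairs \<open>(i, j)\<close>. A monomial is a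
  finitely supported exponent function. The index \<open>j\<close> runs from \<open>1\<close> to \<open>3\<close>; vector and
  matrix accesses are \<open>0\<close>-based.\<close>

type_synonym 'a zpoly = "((nat \<times> nat) \<Rightarrow>\<^sub>0 nat) \<Rightarrow>\<^sub>0 'a"

definition zvar :: "nat \<Rightarrow> nat \<Rightarrow> 'a::comm_ring_1 zpoly" where
  "zvar i j = Poly_Mapping.single (Poly_Mapping.single (i, j) 1) 1"

definition mon_eval :: "(nat \<times> nat \<Rightarrow> 'a::comm_ring_1) \<Rightarrow> (nat \<times> nat \<Rightarrow>\<^sub>0 nat) \<Rightarrow> 'a" where
  "mon_eval la m = (\<Prod>v\<in>Poly_Mapping.keys m. la v ^ Poly_Mapping.lookup m v)"

definition zeval :: "(nat \<times> nat \<Rightarrow> 'a::comm_ring_1) \<Rightarrow> 'a zpoly \<Rightarrow> 'a" where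
  "zeval la p = (\<Sum>m\<in>Poly_Mapping.keys p. Poly_Mapping.lookup p m * mon_eval la m)"

definition subst_z :: "(nat \<times> nat \<Rightarrow> 'a::comm_ring_1) \<Rightarrow> 'a zpoly poly poly \<Rightarrow> 'a poly poly" where
  "subst_z la = map_poly (map_poly (zeval la))"

definition zring :: "nat \<Rightarrow> 'a::comm_ring_1 zpoly set" where
  "zring d = {p. \<forall>m\<in>Poly_Mapping.keys p. Poly_Mapping.keys m \<subseteq> {0..d} \<times> {1..3}}"

definition lam :: "nat \<Rightarrow> 'a::zero poly poly vec \<Rightarrow> nat \<times> nat \<Rightarrow> 'a" where
  "lam d g = (\<lambda>(i, j). Polynomial.coeff (Polynomial.coeff (g $ (j - 1)) (d - i)) i)"

definition zero_locus :: "nat \<Rightarrow> 'a::field zpoly set \<Rightarrow> 'a poly poly vec set" where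
  "zero_locus d S = {g \<in> form_triples d. \<forall>f\<in>S. zeval (lam d g) f = 0}"

text \<open>The Zariski topology of affine \<open>(3d+3)\<close>-space, carried over to the triples of forms of
  degree \<open>d\<close> along the coefficient map.\<close>

definition zariski :: "nat \<Rightarrow> 'a::field poly poly vec topology" where
  "zariski d = topology (\<lambda>U. \<exists>S\<subseteq>zring d. U = form_triples d - zero_locus d S)"

lemma mon_eval_superset:
  assumes "finite V" "Poly_Mapping.keys m \<subseteq> V"
  shows "mon_eval la m = (\<Prod>v\<in>V. la v ^ Poly_Mapping.lookup m v)"
  unfolding mon_eval_def
  by (rule prod.mono_neutral_left) (use assms in \<open>auto simp: in_keys_iff\<close>)

lemma mon_eval_0 [simp]: "mon_eval la 0 = 1"
  by (simp add: mon_eval_def)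

lemma mon_eval_add: "mon_eval la (m + n) = mon_eval la m * mon_eval la n"
proof -
  let ?V = "Poly_Mapping.keys m \<union> Poly_Mapping.keys n"
  have "Poly_Mapping.keys (m + n) \<subseteq> ?V"
    by (rule Poly_Mapping.keys_add)
  then show ?thesis
    by (simp add: mon_eval_superset[of ?V] lookup_add power_add prod.distrib)
qed

lemma zeval_superset:
  assumes "finite M" "Poly_Mapping.keys p \<subseteq> M"
  shows "zeval la p = (\<Sum>m\<in>M. Poly_Mapping.lookup p m * mon_eval la m)"
  unfolding zeval_def
  by (rule sum.mono_neutral_left) (use assms in \<open>auto simp: in_keys_iff\<close>)

lemma zeval_0 [simp]: "zeval la 0 = 0"
  by (simp add: zeval_def)

lemma zeval_1 [simp]: "zeval la 1 = 1"
  by (simp add: zeval_def)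

lemma zeval_add: "zeval la (p + q) = zeval la p + zeval la q"
proof -
  let ?M = "Poly_Mapping.keys p \<union> Poly_Mapping.keys q"
  have "Poly_Mapping.keys (p + q) \<subseteq> ?M"
    by (rule Poly_Mapping.keys_add)
  then show ?thesis
    by (simp add: zeval_superset[of ?M] lookup_add algebra_simps sum.distrib)
qed

lemma zeval_sum: "zeval la (sum f I) = (\<Sum>i\<in>I. zeval la (f i))"
  by (induction I rule: infinite_finite_induct) (simp_all add: zeval_add)

lemma zeval_single: "zeval la (Poly_Mapping.single m a) = a * mon_eval la m"
  by (simp add: zeval_def)

lemma zpoly_sum_single:
  "p = (\<Sum>m\<in>Poly_Mapping.keys p. Poly_Mapping.single m (Poly_Mapping.lookup p m))"
  by (rule poly_mapping_eqI)
    (auto simp: lookup_sum lookup_single when_def in_keys_iff)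

lemma zeval_mult: "zeval la (p * q) = zeval la p * zeval la q"
proof -
  have *: "p * q = (\<Sum>m\<in>Poly_Mapping.keys p. \<Sum>n\<in>Poly_Mapping.keys q.
      Poly_Mapping.single (m + n) (Poly_Mapping.lookup p m * Poly_Mapping.lookup q n))"
    using arg_cong2[OF zpoly_sum_single[of p] zpoly_sum_single[of q], of "(*)"]
    by (simp only: sum_product mult_single)
  show ?thesis
    unfolding * zeval_sum zeval_single mon_eval_add zeval_def[of _ p] zeval_def[of _ q] sum_product
    by (intro sum.cong refl) (simp only: mult_ac)
qed

lemma zring_mult: "p \<in> zring d \<Longrightarrow> q \<in> zring d \<Longrightarrow> p * q \<in> zring d"
proof -
  assume pq: "p \<in> zring d" "q \<in> zring d"
  have "Poly_Mapping.keys m \<subseteq> {0..d} \<times> {1..3}" if m: "m \<in> Poly_Mapping.keys (p * q)" for m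
  proof -
    from m obtain a b where ab: "a \<in> Poly_Mapping.keys p" "b \<in> Poly_Mapping.keys q" "m = a + b"
      using keys_mult[of p q] by blast
    have "Poly_Mapping.keys m \<subseteq> Poly_Mapping.keys a \<union> Poly_Mapping.keys b"
      unfolding ab(3) by (rule Poly_Mapping.keys_add)
    moreover have "Poly_Mapping.keys a \<subseteq> {0..d} \<times> {1..3}" "Poly_Mapping.keys b \<subseteq> {0..d} \<times> {1..3}"
      using pq ab(1,2) unfolding zring_def by blast+
    ultimately show ?thesis by (meson Un_least subset_trans)
  qed
  then show ?thesis unfolding zring_def by blast
qed

lemma istopology_zariski:
  "istopology (\<lambda>U :: 'a::field poly poly vec set.
     \<exists>S\<subseteq>zring d. U = form_triples d - zero_locus d S)"
  unfolding istopology_def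
proof (intro conjI allI impI)
  fix U V :: "'a poly poly vec set"
  assume "\<exists>S\<subseteq>zring d. U = form_triples d - zero_locus d S"
    and "\<exists>S\<subseteq>zring d. V = form_triples d - zero_locus d S"
  then obtain S T where *: "S \<subseteq> zring d" "T \<subseteq> zring d"
      "U = form_triples d - zero_locus d S" "V = form_triples d - zero_locus d T"
    by blast
  let ?ST = "(\<lambda>(p, q). p * q) ` (S \<times> T)"
  have "?ST \<subseteq> zring d"
    using *(1,2) by (auto intro: zring_mult)
  moreover have "U \<inter> V = form_triples d - zero_locus d ?ST"
    unfolding *(3,4) zero_locus_def by (auto simp: zeval_mult)
  ultimately show "\<exists>S\<subseteq>zring d. U \<inter> V = form_triples d - zero_locus d S"
    by blast
next
  fix \<K> :: "'a poly poly vec set set"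
  assume "\<forall>K\<in>\<K>. \<exists>S\<subseteq>zring d. K = form_triples d - zero_locus d S"
  then obtain S where *: "\<And>K. K \<in> \<K> \<Longrightarrow> S K \<subseteq> zring d"
      "\<And>K. K \<in> \<K> \<Longrightarrow> K = form_triples d - zero_locus d (S K)"
    by metis
  have "\<Union>\<K> = (\<Union>K\<in>\<K>. form_triples d - zero_locus d (S K))"
    using *(2) by auto
  also have "\<dots> = form_triples d - zero_locus d (\<Union>K\<in>\<K>. S K)"
    unfolding zero_locus_def by auto
  finally show "\<exists>S\<subseteq>zring d. \<Union>\<K> = form_triples d - zero_locus d S"
    using *(1) by (intro exI[of _ "\<Union>K\<in>\<K>. S K"]) auto
qed

lemma openin_zariski:
  "openin (zariski d) U \<longleftrightarrow> (\<exists>S\<subseteq>zring d. U = form_triples d - zero_locus d S)"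
  unfolding zariski_def by (simp add: topology_inverse'[OF istopology_zariski])


text \<open>The construction of the matrices \<open>d2\<^bsup>(j)\<^esup>\<close>, for \<open>d = 2c\<close>. In the definitions below, \<open>j\<close> and the
  column numbers \<open>i\<close>, \<open>m\<close> are \<open>1\<close>-based.\<close>

definition Ablock :: "nat \<Rightarrow> nat \<Rightarrow> 'a::comm_ring_1 zpoly mat" where
  "Ablock c j = mat (3*c + 1) (c + 1)
     (\<lambda>(r, k). if k \<le> r \<and> r - k \<le> 2*c then zvar (r - k) j else 0)"

definition Amat :: "nat \<Rightarrow> 'a::comm_ring_1 zpoly mat" where
  "Amat c = mat (3*c + 1) (3*c + 3)
     (\<lambda>(r, s). Ablock c (s div (c + 1) + 1) $$ (r, s mod (c + 1)))"

definition Aminor :: "nat \<Rightarrow> nat \<Rightarrow> nat \<Rightarrow> 'a::comm_ring_1 zpoly" where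
  "Aminor c i m = det (submatrix (Amat c) UNIV (UNIV - {i - 1, m - 1}))"

definition bvec :: "nat \<Rightarrow> nat \<Rightarrow> 'a::comm_ring_1 zpoly vec" where
  "bvec c i = vec (3*c + 3) (\<lambda>m'. let m = m' + 1 in
     if m < i then (-1) ^ (m + 1) * Aminor c m i
     else if m = i then 0
     else (-1) ^ m * Aminor c i m)"

definition rho :: "nat \<Rightarrow> 'b::comm_ring_1 poly poly mat" where
  "rho c = mat 1 (c + 1) (\<lambda>(_, k). varx ^ k * vary ^ (c - k))"

definition Nmat :: "nat \<Rightarrow> 'b::comm_ring_1 poly poly mat" where
  "Nmat c = diag_block_mat [rho c, rho c, rho c]"

definition qvec :: "nat \<Rightarrow> nat \<Rightarrow> 'a::comm_ring_1 zpoly poly poly vec" where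
  "qvec c i = Nmat c *\<^sub>v map_vec (\<lambda>a. [:[:a:]:]) (bvec c i)"

definition d2 :: "nat \<Rightarrow> 'a::comm_ring_1 zpoly poly poly mat" where
  "d2 c = mat_of_cols 3 [qvec c 1, qvec c (c + 2), qvec c (2*c + 3)]"

definition d2_del :: "nat \<Rightarrow> nat \<Rightarrow> 'a::comm_ring_1 zpoly poly poly mat" where
  "d2_del c j = submatrix (d2 c) UNIV (UNIV - {j - 1})"

end

theory Submission
  imports Defs
begin

text \<open>
  A vector in the kernel of \<open>A\<close>, evaluated at \<open>g\<close>, is the list of coefficients of three forms
  \<open>f\<^sub>0, f\<^sub>1, f\<^sub>2\<close> of degree \<open>c\<close> with \<open>g\<^sub>0 f\<^sub>0 + g\<^sub>1 f\<^sub>1 + g\<^sub>2 f\<^sub>2 = 0\<close>: row \<open>r\<close> of \<open>A\<close> computes the coefficient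
  of \<open>x^r y^(3c-r)\<close> in that sum. If \<open>g\<close> is balanced, with Hilbert-Burch matrix \<open>\<phi>\<close> whose entries
  have degree \<open>c\<close>, then such a syzygy is \<open>\<phi> w\<close> for some \<open>w\<close>, and comparing the parts of degree \<open>c\<close>
  replaces \<open>w\<close> by its constant term. Hence every vector in the kernel of \<open>A\<close> comes from a vector
  \<open>s \<in> k\<^sup>2\<close> of constants (lemma \<open>syzygy_of_degree_c\<close>).

  The columns \<open>1\<close>, \<open>c+2\<close>, \<open>2c+3\<close> of \<open>A\<close> are those belonging to the coefficients of \<open>y^c\<close>, so the three
  corresponding entries of a kernel vector are the value of the syzygy at \<open>(0,1)\<close>. The value
  \<open>\<phi>(0,1)\<close>, a \<open>3\<times>2\<close> matrix over \<open>k\<close>, is injective (lemma \<open>value_at_01_injective\<close>): a combination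
  of the columns of \<open>\<phi>\<close> that vanishes there is divisible by \<open>x\<close>, its quotient by \<open>x\<close> is again
  a syzygy, hence of the form \<open>\<phi> w\<close>, and injectivity of \<open>\<phi>\<close> makes a constant vector equal to \<open>x w\<close>.
  So some two rows of \<open>\<phi>(0,1)\<close> form an invertible matrix. If \<open>i < m\<close> are the two columns of \<open>A\<close> that
  belong to these rows, then \<open>A(i,m)\<close> does not vanish at \<open>g\<close>: otherwise \<open>A\<close> would have a nonzero
  kernel vector whose entries \<open>i\<close> and \<open>m\<close> are zero, coming from a nonzero \<open>s\<close> that is
  annihilated by both rows. Therefore the three loci \<open>A(i,m) \<noteq> 0\<close>, which are open since \<open>A(i,m)\<close>
  is a polynomial in the coefficients of \<open>g\<close>, cover the set of balanced triples.

  On the locus \<open>A(i,m) \<noteq> 0\<close> the vectors \<open>b\<close> with upper index \<open>i\<close> and \<open>m\<close> lie in the kernel of \<open>A\<close>,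
  by Laplace expansion of a determinant with a repeated row, and are linearly independent, since
  their entries at \<open>i\<close> and \<open>m\<close> are \<open>0, \<plusminus>A(i,m)\<close> and \<open>\<plusminus>A(i,m), 0\<close>. So the two remaining columns of the
  matrix of the theorem are \<open>\<phi>\<close> times an invertible \<open>2\<times>2\<close> matrix of constants, and the
  Hilbert-Burch property is inherited from \<open>\<phi>\<close> (lemma \<open>hilbert_burch_change_basis\<close>).
\<close>


section \<open>Maximal minors of a matrix with two columns too many\<close>

lemma pick_Compl_pair:
  assumes "p < q"
  shows "pick (UNIV - {p, q}) s = insert_index q (insert_index p s)"
proof -
  let ?I = "UNIV - {p, q}" and ?i = "insert_index q (insert_index p s)"
  have "card {a \<in> ?I. a < ?i} = s"
  proof -
    consider "s < p" | "p \<le> s" "s + 1 < q" | "q \<le> s + 1" "p \<le> s" using assms by linarith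
    then show ?thesis
    proof cases
      case 1
      then have "{a \<in> ?I. a < ?i} = {..<s}" using assms by (auto simp: insert_index_def)
      then show ?thesis by simp
    next
      case 2
      then have "{a \<in> ?I. a < ?i} = {..<s + 1} - {p}"
        using assms by (auto simp: insert_index_def)
      then show ?thesis using 2 by simp
    next
      case 3
      then have "{a \<in> ?I. a < ?i} = {..<s + 2} - {p, q}"
        using assms by (auto simp: insert_index_def)
      moreover have "card ({..<s + 2} - {p, q}) = s"
        using 3 assms by (subst card_Diff_subset) auto
      ultimately show ?thesis by simp
    qed
  qed
  moreover have "?i \<in> ?I" using assms by (auto simp: insert_index_def)
  ultimately show ?thesis using pick_card_in_set[of ?i ?I] by simp
qed

lemma submatrix_Compl_pair:
  assumes A: "A \<in> carrier_mat n (n + 2)" and pq: "p < q" "q < n + 2"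
  shows "submatrix A UNIV (UNIV - {p, q})
    = mat n n (\<lambda>(r, s). A $$ (r, insert_index q (insert_index p s)))"
proof -
  have "{j. j < n + 2 \<and> j \<in> UNIV - {p, q}} = {..<n + 2} - {p, q}" by auto
  moreover have "card ({..<n + 2} - {p, q}) = n" using pq by (subst card_Diff_subset) auto
  ultimately have "card {j. j < n + 2 \<and> j \<in> UNIV - {p, q}} = n" by simp
  with A show ?thesis
    unfolding submatrix_def using pq
    by (intro eq_matI) (simp_all add: pick_UNIV pick_Compl_pair)
qed

text \<open>Cramer's rule: entry \<open>r\<close> of the product is the Laplace expansion along the first row of the
  determinant of \<open>A\<close> without column \<open>i\<close>, with a copy of row \<open>r\<close> put on top; two rows agree. The sign
  changes at \<open>i\<close> because the columns after \<open>i\<close> move one place to the left.\<close>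

lemma signed_minors_in_kernel:
  fixes A :: "'a::comm_ring_1 mat"
  assumes A: "A \<in> carrier_mat n (n + 2)" and i: "i < n + 2"
  shows "A *\<^sub>v vec (n + 2) (\<lambda>m. if m = i then 0
      else (if m < i then (-1) ^ m else (-1) ^ (m + 1)) * det (submatrix A UNIV (UNIV - {i, m})))
    = 0\<^sub>v n"
proof (rule eq_vecI)
  let ?M = "\<lambda>m. det (submatrix A UNIV (UNIV - {i, m}))"
  let ?b = "\<lambda>m. if m = i then 0 else (if m < i then (-1) ^ m else (-1) ^ (m + 1)) * ?M m"
  fix r assume "r < dim_vec (0\<^sub>v n :: 'a vec)"
  then have r: "r < n" by simp
  \<comment> \<open>The copy of row \<open>r\<close> has index 0, so row \<open>r'\<close> of \<open>A\<close> has index \<open>r' + 1\<close>.\<close>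
  define B where "B = mat (n + 1) (n + 1)
    (\<lambda>(r', s). A $$ (if r' = 0 then r else r' - 1, insert_index i s))"
  have B: "B \<in> carrier_mat (n + 1) (n + 1)" by (simp add: B_def)
  have "row B 0 = row B (r + 1)" using r by (intro eq_vecI) (simp_all add: B_def)
  then have "det B = 0"
    using r by (intro det_identical_rows[OF B, of 0 "r + 1"]) auto
  have minors: "mat_delete B 0 s = submatrix A UNIV (UNIV - {i, insert_index i s})"
    if s: "s < n + 1" for s
  proof (cases "s < i")
    case True
    have "submatrix A UNIV (UNIV - {s, i})
      = mat n n (\<lambda>(r, t). A $$ (r, insert_index i (insert_index s t)))"
      by (rule submatrix_Compl_pair[OF A True i])
    moreover have "{i, insert_index i s} = {s, i}" using True by auto
    ultimately show ?thesis using True s unfolding mat_delete_def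
      by (intro eq_matI) (auto simp: B_def insert_index_def)
  next
    case False
    have "submatrix A UNIV (UNIV - {i, s + 1})
      = mat n n (\<lambda>(r, t). A $$ (r, insert_index (s + 1) (insert_index i t)))"
      using False s by (intro submatrix_Compl_pair[OF A]) auto
    moreover have "{i, insert_index i s} = {i, s + 1}" using False by auto
    ultimately show ?thesis using False s unfolding mat_delete_def
      by (intro eq_matI) (auto simp: B_def insert_index_def)
  qed
  have "(\<Sum>m\<in>{0..<n + 2}. A $$ (r, m) * ?b m) = (\<Sum>m\<in>{0..<Suc (n + 1)} - {i}. A $$ (r, m) * ?b m)"
    by (rule sum.mono_neutral_right) auto
  also have "\<dots> = (\<Sum>s\<in>{0..<n + 1}. A $$ (r, insert_index i s) * ?b (insert_index i s))"
    using i by (subst insert_index_image[symmetric]) (auto simp: sum.reindex insert_index_inj_on)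
  also have "\<dots> = (\<Sum>s<n + 1. B $$ (0, s) * cofactor B 0 s)"
    unfolding lessThan_atLeast0
  proof (intro sum.cong refl)
    fix s assume "s \<in> {0..<n + 1}"
    then have s: "s < n + 1" by simp
    have "cofactor B 0 s = (-1) ^ s * ?M (insert_index i s)" by (simp add: cofactor_def minors[OF s])
    moreover have "B $$ (0, s) = A $$ (r, insert_index i s)" using s by (simp add: B_def)
    moreover have "?b (insert_index i s) = (-1) ^ s * ?M (insert_index i s)"
      by (cases "s < i") simp_all
    ultimately show "A $$ (r, insert_index i s) * ?b (insert_index i s) = B $$ (0, s) * cofactor B 0 s"
      by (simp only:)
  qed
  also have "\<dots> = det B" using laplace_expansion_row[OF B, of 0] by simp
  finally show "(A *\<^sub>v vec (n + 2) ?b) $ r = 0\<^sub>v n $ r"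
    using A r \<open>det B = 0\<close> by (simp add: scalar_prod_def)
qed (use A in auto)

lemma kernel_vec_of_vanishing_minor:
  fixes A :: "'a::field mat"
  assumes A: "A \<in> carrier_mat n (n + 2)" and pq: "p < q" "q < n + 2"
    and det: "det (submatrix A UNIV (UNIV - {p, q})) = 0"
  obtains v :: "'a vec" where "v \<in> carrier_vec (n + 2)" "A *\<^sub>v v = 0\<^sub>v n" "v \<noteq> 0\<^sub>v (n + 2)" "v $ p = 0" "v $ q = 0"
proof -
  let ?f = "\<lambda>s. insert_index q (insert_index p s)"
  let ?S = "submatrix A UNIV (UNIV - {p, q})"
  have S: "?S = mat n n (\<lambda>(r, s). A $$ (r, ?f s))" by (rule submatrix_Compl_pair[OF A pq])
  then have "?S \<in> carrier_mat n n" by simp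
  then obtain w where w: "w \<in> carrier_vec n" "w \<noteq> 0\<^sub>v n" "?S *\<^sub>v w = 0\<^sub>v n"
    using det det_0_iff_vec_prod_zero_field by blast
  define g where "g = (\<lambda>m. delete_index p (delete_index q m))"
  have gf: "g (?f s) = s" for s by (simp add: g_def)
  have inj: "inj_on ?f {0..<n}" by (rule inj_on_inverseI) (rule gf)
  \<comment> \<open>The kernel vector \<open>w\<close> of the square submatrix, extended by zero at \<open>p\<close> and \<open>q\<close>.\<close>
  define v where "v = vec (n + 2) (\<lambda>m. if m = p \<or> m = q then 0 else w $ g m)"
  have im: "?f ` {0..<n} = {0..<n + 2} - {p, q}"
  proof -
    have "?f ` {0..<n} = insert_index q ` ({0..<Suc n} - {p})"
      using pq insert_index_image[of p n] by (simp add: image_image[symmetric])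
    also have "\<dots> = insert_index q ` {0..<Suc n} - insert_index q ` {p}"
      by (rule inj_on_image_set_diff[OF insert_index_inj_on[of q UNIV]]) auto
    also have "\<dots> = {0..<n + 2} - {p, q}" using pq insert_index_image[of q "Suc n"] by auto
    finally show ?thesis .
  qed
  have vf: "v $ ?f s = w $ s" if "s < n" for s
  proof -
    have "?f s \<in> {0..<n + 2} - {p, q}"
      unfolding im[symmetric] by (rule imageI) (use that in simp)
    then show ?thesis by (simp add: v_def gf)
  qed
  show ?thesis
  proof
    show "v \<in> carrier_vec (n + 2)" "v $ p = 0" "v $ q = 0" using pq by (simp_all add: v_def)
    show "A *\<^sub>v v = 0\<^sub>v n"
    proof (rule eq_vecI)
      fix r assume "r < dim_vec (0\<^sub>v n :: 'a vec)"
      then have r: "r < n" by simp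
      have "(A *\<^sub>v v) $ r = (\<Sum>m\<in>{0..<n + 2}. A $$ (r, m) * v $ m)"
        using A r by (simp add: scalar_prod_def v_def)
      also have "\<dots> = (\<Sum>m\<in>{0..<n + 2} - {p, q}. A $$ (r, m) * v $ m)"
        by (rule sum.mono_neutral_right) (auto simp: v_def)
      also have "\<dots> = (\<Sum>s\<in>{0..<n}. A $$ (r, ?f s) * v $ ?f s)"
        unfolding im[symmetric] sum.reindex[OF inj] comp_def ..
      also have "\<dots> = (?S *\<^sub>v w) $ r"
        using r w(1) vf by (simp add: S scalar_prod_def)
      finally show "(A *\<^sub>v v) $ r = 0\<^sub>v n $ r" using w(3) by simp
    qed (use A in auto)
    obtain s where "s < n" "w $ s \<noteq> 0"
      using w(1,2) by (auto simp: vec_eq_iff)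
    then have "v $ ?f s \<noteq> 0" "?f s < n + 2"
      using vf pq by (simp_all add: insert_index_def)
    then show "v \<noteq> 0\<^sub>v (n + 2)" by auto
  qed
qed


section \<open>Forms and their coefficient vectors\<close>

abbreviation const :: "'b::zero \<Rightarrow> 'b poly poly" where
  "const a \<equiv> [:[:a:]:]"

text \<open>A vector \<open>v\<close> of length \<open>3(c+1)\<close> consists of three blocks of \<open>c+1\<close> coefficients; this is the form of
  degree \<open>c\<close> given by block \<open>t\<close>.\<close>

definition form_of_coeffs :: "nat \<Rightarrow> 'b::comm_monoid_add vec \<Rightarrow> nat \<Rightarrow> 'b poly poly" where
  "form_of_coeffs c v t = (\<Sum>k\<le>c. monom (monom (v $ (t * (c + 1) + k)) k) (c - k))"

lemma coeff_form_of_coeffs: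
  "poly.coeff (poly.coeff (form_of_coeffs c v t) j) i = (if i + j = c then v $ (t * (c + 1) + i) else 0)"
proof -
  have "poly.coeff (poly.coeff (form_of_coeffs c v t) j) i
      = (\<Sum>k\<le>c. poly.coeff (poly.coeff (monom (monom (v $ (t * (c + 1) + k)) k) (c - k)) j) i)"
    by (simp add: form_of_coeffs_def coeff_sum)
  also have "\<dots> = (\<Sum>k\<le>c. if k = i then if i + j = c then v $ (t * (c + 1) + i) else 0 else 0)"
    by (rule sum.cong) auto
  also have "\<dots> = (if i + j = c then v $ (t * (c + 1) + i) else 0)" by auto
  finally show ?thesis .
qed

text \<open>Only the constant term of \<open>w\<close> contributes to the part of degree \<open>c\<close> of \<open>p w\<close>. This is what turns
  polynomial coefficients of a syzygy into constants.\<close>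

lemma coeff_form_times:
  fixes p w :: "'a::comm_ring_1 poly poly"
  assumes p: "p \<in> forms c" and ij: "i + j = c"
  shows "poly.coeff (poly.coeff (p * w) j) i
    = poly.coeff (poly.coeff p j) i * poly.coeff (poly.coeff w 0) 0"
proof -
  have inner: "poly.coeff (poly.coeff p j' * poly.coeff w (j - j')) i
      = (if j' = j then poly.coeff (poly.coeff p j) i * poly.coeff (poly.coeff w 0) 0 else 0)"
    if "j' \<le> j" for j'
  proof -
    have "poly.coeff (poly.coeff p j' * poly.coeff w (j - j')) i
      = (\<Sum>i'\<le>i. poly.coeff (poly.coeff p j') i' * poly.coeff (poly.coeff w (j - j')) (i - i'))"
      by (simp add: coeff_mult)
    also have "\<dots> = (\<Sum>i'\<le>i. if i' = i then
        (if j' = j then poly.coeff (poly.coeff p j) i * poly.coeff (poly.coeff w 0) 0 else 0) else 0)"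
    proof (rule sum.cong)
      fix i' assume "i' \<in> {..i}"
      then have "poly.coeff (poly.coeff p j') i' = 0" if "i' \<noteq> i \<or> j' \<noteq> j"
        using p ij \<open>j' \<le> j\<close> that by (fastforce simp: forms_def)
      then show "poly.coeff (poly.coeff p j') i' * poly.coeff (poly.coeff w (j - j')) (i - i')
        = (if i' = i then (if j' = j then poly.coeff (poly.coeff p j) i * poly.coeff (poly.coeff w 0) 0
            else 0) else 0)"
        by auto
    qed simp
    also have "\<dots> = (if j' = j then poly.coeff (poly.coeff p j) i * poly.coeff (poly.coeff w 0) 0 else 0)"
      by simp
    finally show ?thesis .
  qed
  have "poly.coeff (poly.coeff (p * w) j) i
      = (\<Sum>j'\<le>j. poly.coeff (poly.coeff p j' * poly.coeff w (j - j')) i)"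
    by (simp add: coeff_mult coeff_sum)
  also have "\<dots> = (\<Sum>j'\<le>j. if j' = j then poly.coeff (poly.coeff p j) i * poly.coeff (poly.coeff w 0) 0 else 0)"
    by (rule sum.cong) (auto simp: inner)
  finally show ?thesis by simp
qed

text \<open>The inner sum, with \<open>i = r\<close>, is the part of row \<open>r\<close> of \<open>A v\<close> that belongs to block \<open>t\<close>.\<close>

lemma coeff_form_times_form_of_coeffs:
  fixes f :: "'a::comm_ring_1 poly poly"
  assumes f: "f \<in> forms (2 * c)"
  shows "poly.coeff (poly.coeff (f * form_of_coeffs c v t) j) i = (if i + j = 3 * c then
      (\<Sum>k\<le>c. (if k \<le> i \<and> i - k \<le> 2 * c
        then poly.coeff (poly.coeff f (2 * c - (i - k))) (i - k) else 0) * v $ (t * (c + 1) + k)) else 0)"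
proof -
  have summand: "poly.coeff (poly.coeff (monom (monom a k) (c - k) * f) j) i
    = (if i + j = 3 * c then (if k \<le> i \<and> i - k \<le> 2 * c
        then poly.coeff (poly.coeff f (2 * c - (i - k))) (i - k) else 0) * a else 0)"
    if k: "k \<le> c" for k a
  proof -
    have "poly.coeff (poly.coeff (monom (monom a k) (c - k) * f) j) i
      = (if c - k \<le> j \<and> k \<le> i then a * poly.coeff (poly.coeff f (j - (c - k))) (i - k) else 0)"
      by (simp add: coeff_monom_mult)
    moreover have "poly.coeff (poly.coeff f (j - (c - k))) (i - k) = 0"
      if "i + j \<noteq> 3 * c" "c - k \<le> j" "k \<le> i"
    proof -
      have "(i - k) + (j - (c - k)) \<noteq> 2 * c" using that k by linarith
      then show ?thesis using f by (auto simp: forms_def)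
    qed
    moreover have "(c - k \<le> j \<and> k \<le> i) = (k \<le> i \<and> i - k \<le> 2 * c)"
      and "k \<le> i \<Longrightarrow> c - k \<le> j \<Longrightarrow> j - (c - k) = 2 * c - (i - k)"
      if "i + j = 3 * c" using that k by linarith+
    ultimately show ?thesis by (cases "i + j = 3 * c") (auto simp: mult.commute)
  qed
  have "poly.coeff (poly.coeff (f * form_of_coeffs c v t) j) i
    = (\<Sum>k\<le>c. poly.coeff (poly.coeff (monom (monom (v $ (t * (c + 1) + k)) k) (c - k) * f) j) i)"
    by (subst mult.commute) (simp add: form_of_coeffs_def sum_distrib_right coeff_sum)
  also have "\<dots> = (\<Sum>k\<le>c. if i + j = 3 * c then (if k \<le> i \<and> i - k \<le> 2 * c
        then poly.coeff (poly.coeff f (2 * c - (i - k))) (i - k) else 0) * v $ (t * (c + 1) + k) else 0)"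
    by (rule sum.cong) (auto simp only: summand atMost_iff)
  finally show ?thesis by (cases "i + j = 3 * c") simp_all
qed

lemma varx_dvd_form:
  fixes p :: "'a::field poly poly"
  assumes p: "p \<in> forms c" and "poly.coeff (poly.coeff p c) 0 = 0"
  shows "varx dvd p"
proof -
  have "poly.coeff (poly.coeff p j) 0 = 0" for j
    using assms unfolding forms_def by (metis (mono_tags, lifting) add_0 mem_Collect_eq)
  then have "[:0, 1:] dvd poly.coeff p j" for j
    using poly_eq_0_iff_dvd[of "poly.coeff p j" 0] by (simp add: poly_0_coeff_0)
  then show ?thesis unfolding varx_def const_poly_dvd_iff by blast
qed

lemma sum_blocks:
  fixes c :: nat and h :: "nat \<Rightarrow> 'b::comm_monoid_add"
  shows "(\<Sum>s<3 * c + 3. h s) = (\<Sum>t<3. \<Sum>k\<le>c. h (t * (c + 1) + k))"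
proof -
  have "(\<Sum>s<3 * c + 3. h s) = (\<Sum>s<3 * (c + 1). h s)" by (simp add: algebra_simps)
  also have "\<dots> = (\<Sum>t<3. sum h {t * (c + 1)..<t * (c + 1) + (c + 1)})"
    by (rule sum.nat_group[symmetric])
  also have "\<dots> = (\<Sum>t<3. \<Sum>k<c + 1. h (t * (c + 1) + k))"
    by (simp add: sum.atLeastLessThan_shift_0[of h] lessThan_atLeast0 del: mult_Suc_right)
  finally show ?thesis by (simp add: lessThan_Suc_atMost)
qed

lemma block_index:
  fixes t :: nat
  assumes "t < 3" "k \<le> c"
  shows "t * (c + 1) + k < 3 * c + 3" "(t * (c + 1) + k) div (c + 1) = t" "(t * (c + 1) + k) mod (c + 1) = k"
proof -
  have "t \<le> 2" using assms by simp
  then have "t * (c + 1) \<le> 2 * (c + 1)" by (rule mult_right_mono) simp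
  then show "t * (c + 1) + k < 3 * c + 3" using assms by simp
  show "(t * (c + 1) + k) div (c + 1) = t" "(t * (c + 1) + k) mod (c + 1) = k"
    using assms by (simp_all del: mult_Suc_right add: Suc_eq_plus1[symmetric])
qed

lemma dim_Nmat [simp]: "dim_row (Nmat c) = 3" "dim_col (Nmat c) = 3 * c + 3"
  by (simp_all add: Nmat_def dim_diag_block_mat rho_def)

lemma Nmat_index:
  assumes "t < 3" "s < 3 * c + 3"
  shows "Nmat c $$ (t, s) = (if s div (c + 1) = t
    then varx ^ (s mod (c + 1)) * vary ^ (c - s mod (c + 1)) else 0)"
proof -
  define t' k where "t' = s div (c + 1)" and "k = s mod (c + 1)"
  have s: "s = t' * (c + 1) + k" by (simp only: t'_def k_def div_mult_mod_eq)
  have "s div (c + 1) < 3" by (rule less_mult_imp_div_less) (use assms in simp)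
  then have t': "t' = 0 \<or> t' = 1 \<or> t' = 2" unfolding t'_def by linarith
  have k: "k < c + 1" by (simp add: k_def)
  have "t = 0 \<or> t = 1 \<or> t = 2" using assms by linarith
  then show ?thesis unfolding t'_def[symmetric] k_def[symmetric] unfolding s using t' k
    by (elim disjE) (simp_all add: Nmat_def rho_def Let_def)
qed

lemma varx_power: "varx ^ k = [:monom 1 k:]"
  by (induction k) (simp_all add: varx_def monom_Suc one_pCons monom_0)

lemma vary_power: "vary ^ k = monom 1 k"
  by (induction k) (simp_all add: vary_def monom_Suc monom_0 flip: one_pCons)

lemma Nmat_mult_const_vec:
  fixes v :: "'b::comm_ring_1 vec"
  assumes v: "v \<in> carrier_vec (3 * c + 3)"
  shows "Nmat c *\<^sub>v map_vec const v = vec 3 (form_of_coeffs c v)"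
proof (rule eq_vecI)
  fix t assume "t < dim_vec (vec 3 (form_of_coeffs c v))"
  then have t: "t < 3" by simp
  have monomial: "varx ^ k * vary ^ l * const a = monom (monom a k) l" for a :: 'b and k l
    by (simp add: varx_power vary_power smult_monom)
  have "(Nmat c *\<^sub>v map_vec const v) $ t
      = (\<Sum>s<3 * c + 3. Nmat c $$ (t, s) * const (v $ s))"
    using t v by (simp add: scalar_prod_def lessThan_atLeast0)
  also have "\<dots> = (\<Sum>t'<3. \<Sum>k\<le>c. if t' = t
      then monom (monom (v $ (t * (c + 1) + k)) k) (c - k) else 0)"
  proof (unfold sum_blocks, intro sum.cong refl)
    fix t' k assume "t' \<in> {..<3 :: nat}" "k \<in> {..c}"
    then have *: "t' < 3" "k \<le> c" by simp_all
    have "Nmat c $$ (t, t' * (c + 1) + k)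
        = (if t' = t then varx ^ k * vary ^ (c - k) else (0 :: 'b poly poly))"
      unfolding Nmat_index[OF t block_index(1)[OF *]] block_index(2,3)[OF *] ..
    then show "Nmat c $$ (t, t' * (c + 1) + k) * const (v $ (t' * (c + 1) + k))
        = (if t' = t then monom (monom (v $ (t * (c + 1) + k)) k) (c - k) else 0)"
      by (simp only: monomial split: if_split) simp
  qed
  also have "\<dots> = (\<Sum>t'<3. if t' = t then form_of_coeffs c v t else 0)"
    by (rule sum.cong) (simp_all add: form_of_coeffs_def)
  also have "\<dots> = form_of_coeffs c v t" using t by simp
  finally show "(Nmat c *\<^sub>v map_vec const v) $ t = vec 3 (form_of_coeffs c v) $ t" using t by simp
qed simp


section \<open>The matrix A and the vectors b evaluated at a triple of forms\<close>

lemma comm_ring_hom_zeval: "comm_ring_hom (zeval la)"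
  by unfold_locales (simp_all add: zeval_add zeval_mult)

lemma comm_ring_hom_const: "comm_ring_hom (const :: 'b::comm_ring_1 \<Rightarrow> _)"
  by unfold_locales (simp_all add: one_pCons)

lemma zeval_zvar: "zeval la (zvar i j) = la (i, j)"
  by (simp add: zvar_def zeval_single mon_eval_def)

abbreviation Amat_at :: "nat \<Rightarrow> 'a::field poly poly vec \<Rightarrow> 'a mat" where
  "Amat_at c g \<equiv> map_mat (zeval (lam (2 * c) g)) (Amat c)"

lemma Amat_at_carrier: "Amat_at c g \<in> carrier_mat (3 * c + 1) (3 * c + 1 + 2)"
  by (rule carrier_matI) (simp_all add: Amat_def)

lemma Amat_at_index:
  assumes "t < 3" "k \<le> c" "r < 3 * c + 1"
  shows "Amat_at c g $$ (r, t * (c + 1) + k) = (if k \<le> r \<and> r - k \<le> 2 * c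
    then poly.coeff (poly.coeff (g $ t) (2 * c - (r - k))) (r - k) else 0)"
proof -
  have "Amat_at c g $$ (r, t * (c + 1) + k)
      = zeval (lam (2 * c) g) (Ablock c (t + 1) $$ (r, k))"
    using assms block_index(1)[OF assms(1,2)]
    by (simp add: Amat_def le_imp_less_Suc del: mult_Suc_right)
  then show ?thesis using assms by (simp add: Ablock_def zeval_zvar lam_def)
qed

lemma kernel_Amat_at_gives_syzygy:
  fixes g :: "'a::field poly poly vec"
  assumes g: "g \<in> form_triples (2 * c)" and v: "v \<in> carrier_vec (3 * c + 3)"
    and ker: "Amat_at c g *\<^sub>v v = 0\<^sub>v (3 * c + 1)"
  shows "(\<Sum>t<3. g $ t * form_of_coeffs c v t) = 0"
proof (intro poly_eqI)
  fix i j
  have "(\<Sum>t<3. poly.coeff (poly.coeff (g $ t * form_of_coeffs c v t) j) i) = 0"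
  proof (cases "i + j = 3 * c")
    case True
    then have i: "i < 3 * c + 1" by simp
    have "(\<Sum>t<3. poly.coeff (poly.coeff (g $ t * form_of_coeffs c v t) j) i)
      = (\<Sum>t<3. \<Sum>k\<le>c. Amat_at c g $$ (i, t * (c + 1) + k) * v $ (t * (c + 1) + k))"
    proof (intro sum.cong refl)
      fix t assume "t \<in> {..<3 :: nat}"
      then have t: "t < 3" by simp
      then have "g $ t \<in> forms (2 * c)" using g by (simp add: form_triples_def)
      then show "poly.coeff (poly.coeff (g $ t * form_of_coeffs c v t) j) i
        = (\<Sum>k\<le>c. Amat_at c g $$ (i, t * (c + 1) + k) * v $ (t * (c + 1) + k))"
        unfolding coeff_form_times_form_of_coeffs[OF \<open>g $ t \<in> _\<close>] if_P[OF True]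
        by (intro sum.cong refl) (simp only: Amat_at_index[OF t _ i] atMost_iff)
    qed
    also have "\<dots> = (\<Sum>s<3 * c + 3. Amat_at c g $$ (i, s) * v $ s)" by (rule sum_blocks[symmetric])
    also have "\<dots> = (Amat_at c g *\<^sub>v v) $ i"
      using i v Amat_at_carrier[of c g] by (simp add: scalar_prod_def lessThan_atLeast0)
    finally show ?thesis using ker i by simp
  next
    case False
    then show ?thesis using g
      by (intro sum.neutral ballI) (simp add: coeff_form_times_form_of_coeffs form_triples_def)
  qed
  then show "poly.coeff (poly.coeff (\<Sum>t<3. g $ t * form_of_coeffs c v t) j) i
      = poly.coeff (poly.coeff 0 j) i"
    by (simp add: coeff_sum)
qed

lemma map_mat_submatrix: "map_mat f (submatrix A I J) = submatrix (map_mat f A) I J"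
proof (rule eq_matI)
  fix i j assume "i < dim_row (submatrix (map_mat f A) I J)" "j < dim_col (submatrix (map_mat f A) I J)"
  then have "i < card {i. i < dim_row A \<and> i \<in> I}" "j < card {j. j < dim_col A \<and> j \<in> J}"
    by (simp_all add: dim_submatrix)
  then show "map_mat f (submatrix A I J) $$ (i, j) = submatrix (map_mat f A) I J $$ (i, j)"
    using pick_le[of i "dim_row A" I] pick_le[of j "dim_col A" J]
    by (simp add: submatrix_index dim_submatrix)
qed (simp_all add: dim_submatrix)

lemma zeval_Aminor:
  "zeval la (Aminor c (p + 1) (q + 1))
    = det (submatrix (map_mat (zeval la) (Amat c)) UNIV (UNIV - {p, q}))"
proof -
  interpret comm_ring_hom "zeval la" by (rule comm_ring_hom_zeval)
  show ?thesis unfolding Aminor_def map_mat_submatrix[symmetric] hom_det by simp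
qed

abbreviation bvec_at :: "nat \<Rightarrow> 'a::field poly poly vec \<Rightarrow> nat \<Rightarrow> 'a vec" where
  "bvec_at c g i \<equiv> map_vec (zeval (lam (2 * c) g)) (bvec c (i + 1))"

lemma bvec_at_eq:
  "bvec_at c g i = vec (3 * c + 1 + 2) (\<lambda>m. if m = i then 0
      else (if m < i then (-1) ^ m else (-1) ^ (m + 1)) *
        det (submatrix (Amat_at c g) UNIV (UNIV - {i, m})))"
proof -
  interpret comm_ring_hom "zeval (lam (2 * c) g)" by (rule comm_ring_hom_zeval)
  have sign: "zeval (lam (2 * c) g) ((-1) ^ m * p) = (-1) ^ m * zeval (lam (2 * c) g) p" for m p
    by (simp add: hom_mult hom_power hom_uminus)
  show ?thesis
  proof (rule eq_vecI)
    fix m assume "m < dim_vec (vec (3 * c + 1 + 2) (\<lambda>m. if m = i then 0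
      else (if m < i then (-1) ^ m else (-1) ^ (m + 1)) *
        det (submatrix (Amat_at c g) UNIV (UNIV - {i, m}))))"
    then have m: "m < 3 * c + 1 + 2" "m < 3 * c + 3" by simp_all
    have index: "bvec_at c g i $ m = zeval (lam (2 * c) g) (bvec c (i + 1) $ m)"
      using m by (simp add: bvec_def)
    have entry: "bvec c (i + 1) $ m = (if m = i then 0 else if m < i
        then (-1) ^ m * Aminor c (m + 1) (i + 1) else (-1) ^ (m + 1) * Aminor c (i + 1) (m + 1))"
      using m by (simp add: bvec_def Let_def)
    have "bvec_at c g i $ m = (if m = i then 0 else if m < i
        then (-1) ^ m * det (submatrix (Amat_at c g) UNIV (UNIV - {m, i}))
        else (-1) ^ (m + 1) * det (submatrix (Amat_at c g) UNIV (UNIV - {i, m})))"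
      unfolding index entry
      by (simp only: if_distrib[of "zeval (lam (2 * c) g)"] sign zeval_Aminor hom_zero)
    then show "bvec_at c g i $ m = vec (3 * c + 1 + 2) (\<lambda>m. if m = i then 0
      else (if m < i then (-1) ^ m else (-1) ^ (m + 1)) *
        det (submatrix (Amat_at c g) UNIV (UNIV - {i, m}))) $ m"
      unfolding index_vec[OF m(1)] insert_commute[of m i "{}"] by simp
  qed (simp add: bvec_def)
qed

lemma bvec_at_in_kernel:
  assumes "i < 3 * c + 3"
  shows "Amat_at c g *\<^sub>v bvec_at c g i = 0\<^sub>v (3 * c + 1)"
  unfolding bvec_at_eq by (rule signed_minors_in_kernel[OF Amat_at_carrier]) (use assms in simp)


section \<open>Openness of the non-vanishing of a minor\<close>

lemma zring_add: "p \<in> zring d \<Longrightarrow> q \<in> zring d \<Longrightarrow> p + q \<in> zring d"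
  using Poly_Mapping.keys_add[of p q] unfolding zring_def by blast

lemma zring_constants: "0 \<in> zring d" "1 \<in> zring d" "- 1 \<in> zring d"
  by (simp_all add: zring_def)

lemma zvar_in_zring: "i \<le> d \<Longrightarrow> 1 \<le> j \<Longrightarrow> j \<le> 3 \<Longrightarrow> zvar i j \<in> zring d"
  by (simp add: zring_def zvar_def)

lemma det_in_zring:
  assumes "\<And>i j. i < dim_row A \<Longrightarrow> j < dim_col A \<Longrightarrow> A $$ (i, j) \<in> zring d"
  shows "det A \<in> zring d"
proof -
  have sum: "sum f I \<in> zring d" if "\<And>x. x \<in> I \<Longrightarrow> f x \<in> zring d"
    for f :: "(nat \<Rightarrow> nat) \<Rightarrow> 'a zpoly" and I
    using that by (induction I rule: infinite_finite_induct) (simp_all add: zring_constants zring_add)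
  have prod: "prod f I \<in> zring d" if "\<And>x. x \<in> I \<Longrightarrow> f x \<in> zring d"
    for f :: "nat \<Rightarrow> 'a zpoly" and I
    using that by (induction I rule: infinite_finite_induct) (simp_all add: zring_constants zring_mult)
  have sign: "signof s \<in> zring d" for s :: "nat \<Rightarrow> nat"
    by (simp add: sign_def zring_constants)
  show ?thesis
  proof (cases "dim_row A = dim_col A")
    case True
    have "A $$ (i, s i) \<in> zring d" if "s permutes {0..<dim_row A}" "i \<in> {0..<dim_row A}" for s i
      using permutes_in_image[OF that(1), of i] that(2) True by (intro assms) auto
    then show ?thesis
      unfolding det_def if_P[OF True] by (intro sum zring_mult sign prod) blast
  qed (simp add: det_def zring_constants)
qed

lemma Aminor_in_zring: "(Aminor c i m :: 'a::comm_ring_1 zpoly) \<in> zring (2 * c)"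
proof -
  let ?A = "Amat c :: 'a zpoly mat"
  have A: "?A $$ (r, s) \<in> zring (2 * c)" if "r < 3 * c + 1" "s < 3 * c + 3" for r s
  proof -
    have "s div (c + 1) < 3" by (rule less_mult_imp_div_less) (use that in simp)
    then show ?thesis using that
      by (simp add: Amat_def Ablock_def zring_constants zvar_in_zring)
  qed
  show ?thesis unfolding Aminor_def
  proof (rule det_in_zring)
    fix r s
    let ?J = "UNIV - {i - 1, m - 1}"
    assume "r < dim_row (submatrix ?A UNIV ?J)" "s < dim_col (submatrix ?A UNIV ?J)"
    then have rs: "r < card {j. j < dim_row ?A \<and> j \<in> UNIV}"
        "s < card {j. j < dim_col ?A \<and> j \<in> ?J}"
      by (simp_all only: dim_submatrix)
    have "pick UNIV r < 3 * c + 1" "pick ?J s < 3 * c + 3"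
      using pick_le[OF rs(1)] pick_le[OF rs(2)] by (simp_all add: Amat_def)
    then show "submatrix ?A UNIV ?J $$ (r, s) \<in> zring (2 * c)"
      by (simp only: submatrix_index[OF rs] A)
  qed
qed

lemma openin_Aminor_nonzero:
  "openin (subtopology (zariski (2 * c)) (Bal (2 * c)))
    {g \<in> Bal (2 * c). zeval (lam (2 * c) g) (Aminor c i m) \<noteq> 0}"
proof -
  have "openin (zariski (2 * c)) (form_triples (2 * c) - zero_locus (2 * c) {Aminor c i m})"
    unfolding openin_zariski using Aminor_in_zring by blast
  moreover have "{g \<in> Bal (2 * c). zeval (lam (2 * c) g) (Aminor c i m) \<noteq> 0}
    = (form_triples (2 * c) - zero_locus (2 * c) {Aminor c i m}) \<inter> Bal (2 * c)"
    by (auto simp: Bal_def zero_locus_def)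
  ultimately show ?thesis unfolding openin_subtopology by blast
qed


section \<open>Syzygies of a balanced triple\<close>

lemma hilbert_burch_change_basis:
  fixes \<phi> :: "'a::field poly poly mat"
  assumes HB: "hilbert_burch G \<phi>" and S: "S \<in> carrier_mat 2 2" and T: "T \<in> carrier_mat 2 2"
    and ST: "S * T = 1\<^sub>m 2" and TS: "T * S = 1\<^sub>m 2"
  shows "hilbert_burch G (\<phi> * S)"
proof -
  have \<phi>: "\<phi> \<in> carrier_mat 3 2" using HB by (simp add: hilbert_burch_def)
  have mv: "(\<phi> * S) *\<^sub>v v = \<phi> *\<^sub>v (S *\<^sub>v v)" if "v \<in> carrier_vec 2" for v
    by (rule assoc_mult_mat_vec[OF \<phi> S that])
  have TS_v: "T *\<^sub>v (S *\<^sub>v v) = v" and ST_v: "S *\<^sub>v (T *\<^sub>v v) = v" if "v \<in> carrier_vec 2" for v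
    using assoc_mult_mat_vec[OF T S that] assoc_mult_mat_vec[OF S T that] ST TS that by simp_all
  have closed: "S *\<^sub>v v \<in> carrier_vec 2" "T *\<^sub>v v \<in> carrier_vec 2" if "v \<in> carrier_vec 2" for v
    using S T that by auto
  have "mat_kernel (\<phi> * S) = {0\<^sub>v 2}"
  proof (intro equalityI subsetI)
    fix v assume "v \<in> mat_kernel (\<phi> * S)"
    then have v: "v \<in> carrier_vec 2" "(\<phi> * S) *\<^sub>v v = 0\<^sub>v 3"
      using \<phi> S by (auto simp: mat_kernel_def)
    then have "S *\<^sub>v v \<in> mat_kernel \<phi>" using \<phi> closed by (simp add: mat_kernel_def mv)
    then have "S *\<^sub>v v = 0\<^sub>v 2" using HB by (simp add: hilbert_burch_def)
    then have "v = T *\<^sub>v 0\<^sub>v 2" using TS_v[OF v(1)] by simp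
    then show "v \<in> {0\<^sub>v 2}" using T by auto
  next
    fix v assume v: "v \<in> {0\<^sub>v 2 :: 'a poly poly vec}"
    have "S *\<^sub>v 0\<^sub>v 2 = 0\<^sub>v 2" "\<phi> *\<^sub>v 0\<^sub>v 2 = 0\<^sub>v 3"
      using \<phi> S by (intro eq_vecI; simp)+
    then have "(\<phi> * S) *\<^sub>v 0\<^sub>v 2 = 0\<^sub>v 3" by (simp add: mv)
    then show "v \<in> mat_kernel (\<phi> * S)" using \<phi> S v by (simp add: mat_kernel_def)
  qed
  moreover have "(\<lambda>v. (\<phi> * S) *\<^sub>v v) ` carrier_vec 2 = (\<lambda>v. \<phi> *\<^sub>v v) ` carrier_vec 2"
  proof (intro equalityI subsetI)
    fix w assume "w \<in> (\<lambda>v. \<phi> *\<^sub>v v) ` carrier_vec 2"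
    then obtain v where v: "v \<in> carrier_vec 2" "w = \<phi> *\<^sub>v v" by blast
    then have "w = (\<phi> * S) *\<^sub>v (T *\<^sub>v v)" by (simp add: mv closed ST_v)
    then show "w \<in> (\<lambda>v. (\<phi> * S) *\<^sub>v v) ` carrier_vec 2" using closed v by blast
  qed (auto simp: mv closed)
  moreover have "\<phi> * S \<in> carrier_mat 3 2" by (rule mult_carrier_mat[OF \<phi> S])
  ultimately show ?thesis using HB by (simp add: hilbert_burch_def)
qed

lemma mat_kernel_d1:
  fixes g :: "'a::field poly poly vec"
  assumes "g \<in> carrier_vec 3"
  shows "v \<in> mat_kernel (d1 g) \<longleftrightarrow> v \<in> carrier_vec 3 \<and> (\<Sum>t<3. g $ t * v $ t) = 0"
proof -
  have "d1 g *\<^sub>v v = 0\<^sub>v 1 \<longleftrightarrow> (\<Sum>t<3. g $ t * v $ t) = 0" if "v \<in> carrier_vec 3"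
    using assms that by (auto simp: d1_def vec_eq_iff scalar_prod_def lessThan_atLeast0)
  then show ?thesis by (auto simp: mat_kernel_def d1_def)
qed

lemma mult_const_vec_index:
  fixes \<phi> :: "'a::field poly poly mat"
  assumes "\<phi> \<in> carrier_mat 3 2" "s \<in> carrier_vec 2" "t < 3"
  shows "(\<phi> *\<^sub>v map_vec const s) $ t = \<phi> $$ (t, 0) * const (s $ 0) + \<phi> $$ (t, 1) * const (s $ 1)"
  using assms by (simp add: scalar_prod_def numeral_2_eq_2)

text \<open>Exactness gives \<open>w\<close> over \<open>k[x,y]\<close> with \<open>\<phi> w\<close> equal to the syzygy; since all the forms have the same
  degree \<open>c\<close>, the constant term \<open>s\<close> of \<open>w\<close> does the same.\<close>

lemma syzygy_of_degree_c:
  fixes \<phi> :: "'a::field poly poly mat"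
  assumes HB: "hilbert_burch (d1 g) \<phi>" and g: "g \<in> form_triples (2 * c)"
    and deg: "\<forall>i<3. \<forall>l<2. \<phi> $$ (i, l) \<in> forms c"
    and v: "v \<in> carrier_vec (3 * c + 3)" and ker: "Amat_at c g *\<^sub>v v = 0\<^sub>v (3 * c + 1)"
  obtains s :: "'a vec" where "s \<in> carrier_vec 2"
    "vec 3 (form_of_coeffs c v) = \<phi> *\<^sub>v map_vec const s"
proof -
  have \<phi>: "\<phi> \<in> carrier_mat 3 2" using HB by (simp add: hilbert_burch_def)
  have g3: "g \<in> carrier_vec 3" using g by (simp add: form_triples_def)
  let ?F = "vec 3 (form_of_coeffs c v)"
  have "?F \<in> mat_kernel (d1 g)"
    using kernel_Amat_at_gives_syzygy[OF g v ker] by (simp add: mat_kernel_d1[OF g3])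
  then obtain w where w: "w \<in> carrier_vec 2" "?F = \<phi> *\<^sub>v w"
    using HB by (auto simp: hilbert_burch_def)
  define s where "s = map_vec (\<lambda>p. poly.coeff (poly.coeff p 0) 0) w"
  have s: "s \<in> carrier_vec 2" using w by (simp add: s_def)
  have "?F = \<phi> *\<^sub>v map_vec const s"
  proof (rule eq_vecI)
    fix t assume "t < dim_vec (\<phi> *\<^sub>v map_vec const s)"
    then have t: "t < 3" using \<phi> by simp
    have forms: "\<phi> $$ (t, 0) \<in> forms c" "\<phi> $$ (t, 1) \<in> forms c" using deg t by auto
    have F: "form_of_coeffs c v t = \<phi> $$ (t, 0) * w $ 0 + \<phi> $$ (t, 1) * w $ 1"
    proof -
      have "?F $ t = (\<phi> *\<^sub>v w) $ t" using w(2) by simp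
      then show ?thesis using t \<phi> w(1) by (simp add: scalar_prod_def numeral_2_eq_2)
    qed
    have "form_of_coeffs c v t = \<phi> $$ (t, 0) * const (s $ 0) + \<phi> $$ (t, 1) * const (s $ 1)"
    proof (intro poly_eqI)
      fix j i
      show "poly.coeff (poly.coeff (form_of_coeffs c v t) j) i = poly.coeff (poly.coeff
          (\<phi> $$ (t, 0) * const (s $ 0) + \<phi> $$ (t, 1) * const (s $ 1)) j) i"
      proof (cases "i + j = c")
        case True
        show ?thesis
          unfolding F coeff_add coeff_form_times[OF forms(1) True] coeff_form_times[OF forms(2) True]
          using w(1) by (simp add: s_def)
      next
        case False
        then have "poly.coeff (poly.coeff (\<phi> $$ (t, 0)) j) i = 0"
            "poly.coeff (poly.coeff (\<phi> $$ (t, 1)) j) i = 0"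
          using forms by (auto simp: forms_def)
        then show ?thesis using False by (simp add: coeff_form_of_coeffs)
      qed
    qed
    then show "?F $ t = (\<phi> *\<^sub>v map_vec const s) $ t"
      using t by (simp only: index_vec mult_const_vec_index[OF \<phi> s t])
  qed (use \<phi> in simp)
  then show ?thesis using that s by blast
qed

text \<open>The coefficient of \<open>y^c\<close> in a form of degree \<open>c\<close> is its value at \<open>(0,1)\<close>. If \<open>\<phi> s\<close> vanishes there,
  it is \<open>x\<close> times a syzygy \<open>\<phi> w\<close>, so \<open>s = x w\<close> because \<open>\<phi>\<close> is injective, and the constant \<open>s\<close> is zero.\<close>

lemma value_at_01_injective:
  fixes \<phi> :: "'a::field poly poly mat" and s :: "'a vec"
  assumes HB: "hilbert_burch (d1 g) \<phi>" and g3: "g \<in> carrier_vec 3"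
    and deg: "\<forall>i<3. \<forall>l<2. \<phi> $$ (i, l) \<in> forms c"
    and s: "s \<in> carrier_vec 2"
    and zero: "\<And>t. t < 3 \<Longrightarrow> poly.coeff (poly.coeff (\<phi> $$ (t, 0)) c) 0 * s $ 0
      + poly.coeff (poly.coeff (\<phi> $$ (t, 1)) c) 0 * s $ 1 = 0"
  shows "s = 0\<^sub>v 2"
proof -
  have \<phi>: "\<phi> \<in> carrier_mat 3 2" using HB by (simp add: hilbert_burch_def)
  let ?w = "\<phi> *\<^sub>v map_vec const s"
  have "varx dvd ?w $ t" if t: "t < 3" for t
  proof (rule varx_dvd_form)
    have forms: "\<phi> $$ (t, 0) \<in> forms c" "\<phi> $$ (t, 1) \<in> forms c" using deg t by auto
    have coeff: "poly.coeff (poly.coeff (?w $ t) j) i = poly.coeff (poly.coeff (\<phi> $$ (t, 0)) j) i * s $ 0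
      + poly.coeff (poly.coeff (\<phi> $$ (t, 1)) j) i * s $ 1" for i j
      unfolding mult_const_vec_index[OF \<phi> s t] by (simp add: mult.commute)
    show "?w $ t \<in> forms c"
      unfolding forms_def
    proof (intro CollectI allI impI, rule ccontr)
      fix i j assume "poly.coeff (poly.coeff (?w $ t) j) i \<noteq> 0" and "i + j \<noteq> c"
      moreover have "poly.coeff (poly.coeff (\<phi> $$ (t, 0)) j) i = 0"
          "poly.coeff (poly.coeff (\<phi> $$ (t, 1)) j) i = 0" if "i + j \<noteq> c"
        using forms that by (auto simp: forms_def)
      ultimately show False by (simp add: coeff)
    qed
    show "poly.coeff (poly.coeff (?w $ t) c) 0 = 0" using zero[OF t] by (simp add: coeff)
  qed
  then have "\<forall>t. \<exists>u. t < 3 \<longrightarrow> ?w $ t = varx * u" unfolding dvd_def by blast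
  then obtain u where u: "\<And>t. t < 3 \<Longrightarrow> ?w $ t = varx * u t" by metis
  have varx_nz: "(varx :: 'a poly poly) \<noteq> 0" by (simp add: varx_def)
  have "?w \<in> mat_kernel (d1 g)"
    using HB s by (auto simp: hilbert_burch_def)
  then have "varx * (\<Sum>t<3. g $ t * u t) = 0"
    by (simp add: mat_kernel_d1[OF g3] u sum_distrib_left mult.left_commute)
  then have "vec 3 u \<in> mat_kernel (d1 g)"
    using varx_nz by (simp add: mat_kernel_d1[OF g3])
  then obtain w where w: "w \<in> carrier_vec 2" "vec 3 u = \<phi> *\<^sub>v w"
    using HB by (auto simp: hilbert_burch_def)
  have cs: "map_vec const s \<in> carrier_vec 2" using s by simp
  have xw: "varx \<cdot>\<^sub>v w \<in> carrier_vec 2" using w by simp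
  have "?w = varx \<cdot>\<^sub>v vec 3 u" using \<phi> by (intro eq_vecI) (simp_all add: u del: index_mult_mat_vec)
  also have "\<dots> = \<phi> *\<^sub>v (varx \<cdot>\<^sub>v w)" unfolding w(2) using \<phi> w(1)
    by (intro eq_vecI) (simp_all add: scalar_prod_def numeral_2_eq_2 algebra_simps)
  finally have eq: "?w = \<phi> *\<^sub>v (varx \<cdot>\<^sub>v w)" .
  have "\<phi> *\<^sub>v (map_vec const s - varx \<cdot>\<^sub>v w) = 0\<^sub>v 3"
    unfolding mult_minus_distrib_mat_vec[OF \<phi> cs xw] eq using \<phi> by (intro eq_vecI) simp_all
  then have "map_vec const s - varx \<cdot>\<^sub>v w \<in> mat_kernel \<phi>"
    using \<phi> cs xw by (simp add: mat_kernel_def)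
  then have diff: "map_vec const s - varx \<cdot>\<^sub>v w = 0\<^sub>v 2" using HB by (simp add: hilbert_burch_def)
  show ?thesis
  proof (rule eq_vecI)
    fix l assume "l < dim_vec (0\<^sub>v 2 :: 'a vec)"
    then have l: "l < 2" by simp
    have "(map_vec const s - varx \<cdot>\<^sub>v w) $ l = 0" unfolding diff using l by simp
    then have "const (s $ l) = varx * w $ l" using l s w(1) by simp
    then have "poly.coeff (poly.coeff (const (s $ l)) 0) 0 = poly.coeff (poly.coeff (varx * w $ l) 0) 0"
      by simp
    then show "s $ l = 0\<^sub>v 2 $ l" using l by (simp add: varx_def)
  qed (use s in simp)
qed

text \<open>If all minors vanish, then every row is a multiple of a nonzero row \<open>(a p, b p)\<close> and therefore
  annihilates \<open>(b p, - a p)\<close>.\<close>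

lemma injective_3x2_has_minor:
  fixes a b :: "nat \<Rightarrow> 'a::field"
  assumes inj: "\<And>s0 s1. \<forall>t<3. a t * s0 + b t * s1 = 0 \<Longrightarrow> s0 = 0 \<and> s1 = 0"
  obtains p q where "p < q" "q < 3" "a p * b q \<noteq> a q * b p"
proof -
  have "\<exists>p<3. \<exists>q<3. a p * b q \<noteq> a q * b p"
  proof (rule ccontr)
    assume "\<not> ?thesis"
    then have minors: "a p * b q = a q * b p" if "p < 3" "q < 3" for p q using that by blast
    \<comment> \<open>A row is nonzero because \<open>(1, 1)\<close> is not annihilated by all of them.\<close>
    obtain p where p: "p < 3" "a p \<noteq> 0 \<or> b p \<noteq> 0" using inj[of 1 1] by fastforce
    have "\<forall>t<3. a t * b p + b t * (- a p) = 0" using minors[OF _ p(1)] by (simp add: mult.commute)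
    then show False using inj[of "b p" "- a p"] p(2) by simp
  qed
  then obtain p q where pq: "p < 3" "q < 3" "a p * b q \<noteq> a q * b p" by blast
  then consider "p < q" | "q < p" by fastforce
  then show ?thesis using that[of p q] that[of q p] pq by cases auto
qed

lemma kernel_2x2_trivial:
  fixes a b a' b' x y :: "'a::field"
  assumes det: "a * b' \<noteq> a' * b" and "a * x + b * y = 0" "a' * x + b' * y = 0"
  shows "x = 0 \<and> y = 0"
proof -
  have "(a * b' - a' * b) * x = (a * x + b * y) * b' - (a' * x + b' * y) * b"
    "(a * b' - a' * b) * y = (a' * x + b' * y) * a - (a * x + b * y) * a'"
    by (simp_all add: algebra_simps)
  then have "(a * b' - a' * b) * x = 0" "(a * b' - a' * b) * y = 0"
    using assms(2,3) by simp_all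
  then show ?thesis using det by simp
qed


section \<open>The open cover\<close>

lemma Bal_has_nonzero_minor:
  fixes g :: "'a::field poly poly vec"
  assumes "g \<in> Bal (2 * c)"
  obtains p q where "p < q" "q < 3"
    "zeval (lam (2 * c) g) (Aminor c (p * (c + 1) + 1) (q * (c + 1) + 1)) \<noteq> 0"
proof -
  obtain \<phi> where HB: "hilbert_burch (d1 g) \<phi>" and deg: "\<forall>i<3. \<forall>l<2. \<phi> $$ (i, l) \<in> forms c"
    using assms by (auto simp: Bal_def homogeneous_hilbert_burch_def)
  have g: "g \<in> form_triples (2 * c)" using assms by (simp add: Bal_def)
  then have g3: "g \<in> carrier_vec 3" by (simp add: form_triples_def)
  have \<phi>: "\<phi> \<in> carrier_mat 3 2" using HB by (simp add: hilbert_burch_def)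
  let ?a = "\<lambda>t. poly.coeff (poly.coeff (\<phi> $$ (t, 0)) c) 0"
  let ?b = "\<lambda>t. poly.coeff (poly.coeff (\<phi> $$ (t, 1)) c) 0"
  have inj: "s0 = 0 \<and> s1 = 0" if "\<forall>t<3. ?a t * s0 + ?b t * s1 = 0" for s0 s1
  proof -
    have "vec_of_list [s0, s1] = 0\<^sub>v 2"
      by (rule value_at_01_injective[OF HB g3 deg]) (use that in \<open>simp_all add: carrier_vecI\<close>)
    then have "vec_of_list [s0, s1] $ 0 = 0" "vec_of_list [s0, s1] $ 1 = 0" by simp_all
    then show ?thesis by simp
  qed
  obtain p q where pq: "p < q" "q < 3" "?a p * ?b q \<noteq> ?a q * ?b p"
    using injective_3x2_has_minor[of ?a ?b] inj by blast
  show ?thesis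
  proof (rule that[OF pq(1,2)], rule notI)
    have less: "p * (c + 1) < q * (c + 1)" "q * (c + 1) < 3 * c + 1 + 2"
      using mult_strict_right_mono[OF pq(1), of "c + 1"] pq block_index(1)[of q 0 c] by simp_all
    assume "zeval (lam (2 * c) g) (Aminor c (p * (c + 1) + 1) (q * (c + 1) + 1)) = 0"
    then obtain v :: "'a vec" where v: "v \<in> carrier_vec (3 * c + 1 + 2)" "Amat_at c g *\<^sub>v v = 0\<^sub>v (3 * c + 1)"
        "v \<noteq> 0\<^sub>v (3 * c + 1 + 2)" "v $ (p * (c + 1)) = 0" "v $ (q * (c + 1)) = 0"
      using kernel_vec_of_vanishing_minor[OF Amat_at_carrier less] by (metis zeval_Aminor)
    have v': "v \<in> carrier_vec (3 * c + 3)" using v(1) by (simp add: numeral_3_eq_3)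
    obtain s :: "'a vec" where s: "s \<in> carrier_vec 2" "vec 3 (form_of_coeffs c v) = \<phi> *\<^sub>v map_vec const s"
      by (rule syzygy_of_degree_c[OF HB g deg v' v(2)])
    have F: "form_of_coeffs c v t = \<phi> $$ (t, 0) * const (s $ 0) + \<phi> $$ (t, 1) * const (s $ 1)"
      if "t < 3" for t
      using arg_cong[OF s(2), of "\<lambda>w :: 'a poly poly vec. w $ t"] that mult_const_vec_index[OF \<phi> s(1) that] by simp
    have row: "v $ (t * (c + 1)) = ?a t * s $ 0 + ?b t * s $ 1" if "t < 3" for t
      using arg_cong[OF F[OF that], of "\<lambda>f. poly.coeff (poly.coeff f c) 0"]
      by (simp add: coeff_form_of_coeffs mult.commute)
    have "?a p * s $ 0 + ?b p * s $ 1 = 0" "?a q * s $ 0 + ?b q * s $ 1 = 0"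
      using row[of p] row[of q] v(4,5) pq by simp_all
    then have s0: "s $ 0 = 0" "s $ 1 = 0"
      using kernel_2x2_trivial[OF pq(3)] by blast+
    have "v = 0\<^sub>v (3 * c + 3)"
    proof (rule eq_vecI)
      fix m assume "m < dim_vec (0\<^sub>v (3 * c + 3) :: 'a vec)"
      then have m: "m < 3 * c + 3" by simp
      define t k where "t = m div (c + 1)" and "k = m mod (c + 1)"
      have tk: "m = t * (c + 1) + k" by (simp only: t_def k_def div_mult_mod_eq)
      have "t < 3" unfolding t_def by (rule less_mult_imp_div_less) (use m in simp)
      moreover have "k < c + 1" by (simp add: k_def)
      ultimately have "v $ m = poly.coeff (poly.coeff (form_of_coeffs c v t) (c - k)) k"
        by (simp add: coeff_form_of_coeffs tk)
      also have "\<dots> = 0" using F[OF \<open>t < 3\<close>] s0 by simp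
      finally show "v $ m = 0\<^sub>v (3 * c + 3) $ m" using m by simp
    qed (use v' in simp)
    then show False using v(3) by (simp add: numeral_3_eq_3)
  qed
qed


section \<open>The specialised matrices are Hilbert-Burch matrices\<close>

text \<open>This numbers the two columns that survive the removal of a column from \<open>d2\<close>.\<close>

lemma pick_Compl_singleton: "pick (UNIV - {p}) s = insert_index p s"
proof -
  have "{a \<in> UNIV - {p}. a < insert_index p s} = (if s < p then {..<s} else {..<s + 1} - {p})"
    by (auto simp: insert_index_def)
  then have "card {a \<in> UNIV - {p}. a < insert_index p s} = s" by simp
  then show ?thesis using pick_card_in_set[of "insert_index p s" "UNIV - {p}"] by simp
qed

lemma subst_z_form_of_coeffs:
  assumes "v \<in> carrier_vec (3 * c + 3)" "t < 3"
  shows "subst_z la (form_of_coeffs c v t) = form_of_coeffs c (map_vec (zeval la) v) t"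
proof (intro poly_eqI)
  fix j i
  have "v $ (t * (c + 1) + i) = v $ (t * (c + 1) + i) \<and>
      zeval la (v $ (t * (c + 1) + i)) = map_vec (zeval la) v $ (t * (c + 1) + i)" if "i \<le> c"
    using block_index(1)[OF assms(2) that] assms(1) by simp
  then show "poly.coeff (poly.coeff (subst_z la (form_of_coeffs c v t)) j) i
    = poly.coeff (poly.coeff (form_of_coeffs c (map_vec (zeval la) v) t) j) i"
    by (auto simp: subst_z_def coeff_map_poly coeff_form_of_coeffs)
qed

lemma subst_z_d2_del:
  assumes j: "j \<in> {1..3}"
  shows "map_mat (subst_z (lam (2 * c) g)) (d2_del c j) = mat 3 2 (\<lambda>(t, l).
    form_of_coeffs c (bvec_at c g (insert_index (j - 1) l * (c + 1))) t)"
proof -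
  have q: "qvec c i = vec 3 (form_of_coeffs c (bvec c i))" for i
    unfolding qvec_def by (rule Nmat_mult_const_vec) (simp add: bvec_def)
  have d2: "d2 c $$ (t, l) = form_of_coeffs c (bvec c (l * (c + 1) + 1)) t" if "t < 3" "l < 3" for t l
  proof -
    have "l = 0 \<or> l = 1 \<or> l = 2" using that by linarith
    then show ?thesis using that by (elim disjE) (simp_all add: d2_def mat_of_cols_def q numeral_3_eq_3)
  qed
  have dim: "dim_row (d2 c) = 3" "dim_col (d2 c) = 3" by (simp_all add: d2_def)
  have "{i. i < (3::nat) \<and> i \<in> UNIV - {j - 1}} = {..<3} - {j - 1}" by auto
  moreover have "card ({..<3} - {j - 1}) = 2" using j by (subst card_Diff_subset) auto
  ultimately have card: "card {i. i < (3::nat) \<and> i \<in> UNIV - {j - 1}} = 2" by simp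
  have del: "d2_del c j = mat 3 2 (\<lambda>(t, l). d2 c $$ (t, insert_index (j - 1) l))"
    unfolding d2_del_def submatrix_def dim card by (simp add: pick_UNIV pick_Compl_singleton)
  show ?thesis
  proof (rule eq_matI)
    fix t l
    assume "t < dim_row (mat 3 2 (\<lambda>(t, l).
        form_of_coeffs c (bvec_at c g (insert_index (j - 1) l * (c + 1))) t))"
      and "l < dim_col (mat 3 2 (\<lambda>(t, l).
        form_of_coeffs c (bvec_at c g (insert_index (j - 1) l * (c + 1))) t))"
    then have tl: "t < 3" "l < 2" by simp_all
    then have "insert_index (j - 1) l < 3" by (simp add: insert_index_def)
    then show "map_mat (subst_z (lam (2 * c) g)) (d2_del c j) $$ (t, l) = mat 3 2 (\<lambda>(t, l).
        form_of_coeffs c (bvec_at c g (insert_index (j - 1) l * (c + 1))) t) $$ (t, l)"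
      using tl by (simp add: del d2 subst_z_form_of_coeffs bvec_def)
  qed (simp_all add: del)
qed

text \<open>The constants \<open>sp\<close>, \<open>sq\<close> that express the two vectors \<open>b\<close> through \<open>\<phi>\<close> form an invertible matrix:
  a linear relation between \<open>sp\<close> and \<open>sq\<close> is one between the vectors \<open>b\<close>, and their entries at the
  two distinguished positions rule this out.\<close>

lemma hilbert_burch_of_nonzero_minor:
  fixes g :: "'a::field poly poly vec"
  assumes "g \<in> Bal (2 * c)" and pq: "p < q" "q < 3"
    and minor: "zeval (lam (2 * c) g) (Aminor c (p * (c + 1) + 1) (q * (c + 1) + 1)) \<noteq> 0"
  shows "hilbert_burch (d1 g) (mat 3 2 (\<lambda>(t, l).
    form_of_coeffs c (bvec_at c g ((if l = 0 then p else q) * (c + 1))) t))"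
proof -
  obtain \<phi> where HB: "hilbert_burch (d1 g) \<phi>" and deg: "\<forall>i<3. \<forall>l<2. \<phi> $$ (i, l) \<in> forms c"
    using assms by (auto simp: Bal_def homogeneous_hilbert_burch_def)
  have g: "g \<in> form_triples (2 * c)" using assms by (simp add: Bal_def)
  have \<phi>: "\<phi> \<in> carrier_mat 3 2" using HB by (simp add: hilbert_burch_def)
  let ?bp = "bvec_at c g (p * (c + 1))" and ?bq = "bvec_at c g (q * (c + 1))"
  have less: "p * (c + 1) < q * (c + 1)" "q * (c + 1) < 3 * c + 3" "p * (c + 1) < 3 * c + 3"
    using mult_strict_right_mono[OF pq(1), of "c + 1"] pq
      block_index(1)[of q 0 c] block_index(1)[of p 0 c] by simp_all
  have carrier: "bvec_at c g i \<in> carrier_vec (3 * c + 3)" for i by (simp add: bvec_def)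
  obtain sp :: "'a vec" where sp: "sp \<in> carrier_vec 2" "vec 3 (form_of_coeffs c ?bp) = \<phi> *\<^sub>v map_vec const sp"
    by (rule syzygy_of_degree_c[OF HB g deg carrier bvec_at_in_kernel[OF less(3)]])
  obtain sq :: "'a vec" where sq: "sq \<in> carrier_vec 2" "vec 3 (form_of_coeffs c ?bq) = \<phi> *\<^sub>v map_vec const sq"
    by (rule syzygy_of_degree_c[OF HB g deg carrier bvec_at_in_kernel[OF less(2)]])
  define S where "S = mat 2 2 (\<lambda>(i, l). (if l = 0 then sp else sq) $ i)"
  have S: "S \<in> carrier_mat 2 2" by (simp add: S_def)
  have Fp: "form_of_coeffs c ?bp t = \<phi> $$ (t, 0) * const (sp $ 0) + \<phi> $$ (t, 1) * const (sp $ 1)"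
    and Fq: "form_of_coeffs c ?bq t = \<phi> $$ (t, 0) * const (sq $ 0) + \<phi> $$ (t, 1) * const (sq $ 1)"
    if "t < 3" for t
    using arg_cong[OF sp(2), of "\<lambda>w :: 'a poly poly vec. w $ t"] arg_cong[OF sq(2), of "\<lambda>w :: 'a poly poly vec. w $ t"] that
      mult_const_vec_index[OF \<phi> sp(1) that] mult_const_vec_index[OF \<phi> sq(1) that] by simp_all
  let ?a = "\<lambda>t. poly.coeff (poly.coeff (\<phi> $$ (t, 0)) c) 0"
  let ?b = "\<lambda>t. poly.coeff (poly.coeff (\<phi> $$ (t, 1)) c) 0"
  have rows: "?bp $ (t * (c + 1)) = ?a t * sp $ 0 + ?b t * sp $ 1"
      "?bq $ (t * (c + 1)) = ?a t * sq $ 0 + ?b t * sq $ 1" if "t < 3" for t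
    using arg_cong[OF Fp[OF that], of "\<lambda>f. poly.coeff (poly.coeff f c) 0"]
      arg_cong[OF Fq[OF that], of "\<lambda>f. poly.coeff (poly.coeff f c) 0"]
    by (simp_all add: coeff_form_of_coeffs mult.commute)
  have entries: "?bp $ (p * (c + 1)) = 0" "?bp $ (q * (c + 1)) \<noteq> 0"
      "?bq $ (p * (c + 1)) \<noteq> 0" "?bq $ (q * (c + 1)) = 0"
    using less minor unfolding bvec_at_eq zeval_Aminor by (simp_all add: insert_commute)
  have "det S \<noteq> 0"
  proof
    assume "det S = 0"
    then obtain u :: "'a vec" where u: "u \<in> carrier_vec 2" "u \<noteq> 0\<^sub>v 2" "S *\<^sub>v u = 0\<^sub>v 2"
      using det_0_iff_vec_prod_zero_field[OF S] by blast
    have "(S *\<^sub>v u) $ i = 0" if "i < 2" for i using u(3) that by simp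
    then have Su: "sp $ i * u $ 0 + sq $ i * u $ 1 = 0" if "i < 2" for i
      using that u(1) by (simp add: S_def scalar_prod_def numeral_2_eq_2)
    have comb: "?bp $ (t * (c + 1)) * u $ 0 + ?bq $ (t * (c + 1)) * u $ 1 = 0" if "t < 3" for t
    proof -
      have "?bp $ (t * (c + 1)) * u $ 0 + ?bq $ (t * (c + 1)) * u $ 1
          = ?a t * (sp $ 0 * u $ 0 + sq $ 0 * u $ 1) + ?b t * (sp $ 1 * u $ 0 + sq $ 1 * u $ 1)"
        unfolding rows[OF that] by (simp add: algebra_simps)
      then show ?thesis using Su[of 0] Su[of 1] by simp
    qed
    have "u $ 1 = 0" "u $ 0 = 0" using comb[of p] comb[of q] entries pq by auto
    then have "u = 0\<^sub>v 2" using u(1) by (auto simp: vec_eq_iff less_2_cases_iff)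
    then show False using u(2) by contradiction
  qed
  then have "S \<in> Units (ring_mat TYPE('a) 2 ())" by (rule det_non_zero_imp_unit[OF S])
  then obtain T where T: "T \<in> carrier_mat 2 2" "T * S = 1\<^sub>m 2" "S * T = 1\<^sub>m 2"
    by (auto simp: Units_def ring_mat_def)
  interpret const: comm_ring_hom "const :: 'a \<Rightarrow> 'a poly poly" by (rule comm_ring_hom_const)
  have "hilbert_burch (d1 g) (\<phi> * map_mat const S)"
  proof (rule hilbert_burch_change_basis[OF HB])
    show "map_mat const S * map_mat const T = 1\<^sub>m 2"
      using const.mat_hom_mult[OF S T(1)] T(3) const.mat_hom_one[of 2] by simp
    show "map_mat const T * map_mat const S = 1\<^sub>m 2"
      using const.mat_hom_mult[OF T(1) S] T(2) const.mat_hom_one[of 2] by simp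
  qed (use S T in simp_all)
  moreover have "\<phi> * map_mat const S = mat 3 2 (\<lambda>(t, l).
      form_of_coeffs c (bvec_at c g ((if l = 0 then p else q) * (c + 1))) t)"
    (is "_ = ?M")
  proof (rule eq_matI)
    fix t l assume "t < dim_row ?M" "l < dim_col ?M"
    then have tl: "t < 3" "l < 2" by simp_all
    let ?s = "if l = 0 then sp else sq"
    have "(\<phi> * map_mat const S) $$ (t, l)
        = \<phi> $$ (t, 0) * const (?s $ 0) + \<phi> $$ (t, 1) * const (?s $ 1)"
      using \<phi> tl by (simp add: S_def scalar_prod_def numeral_2_eq_2)
    also have "\<dots> = form_of_coeffs c (bvec_at c g ((if l = 0 then p else q) * (c + 1))) t"
    proof (cases "l = 0")
      case True
      show ?thesis unfolding if_P[OF True] Fp[OF tl(1)] ..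
    next
      case False
      show ?thesis unfolding if_not_P[OF False] Fq[OF tl(1)] ..
    qed
    finally show "(\<phi> * map_mat const S) $$ (t, l) = ?M $$ (t, l)" using tl by simp
  qed (use \<phi> S in simp_all)
  ultimately show ?thesis by (simp only:)
qed

theorem theorem5p30:
  fixes c d :: nat
  assumes "d = 2 * c" and "d > 0"
  shows "\<exists>Balj :: nat \<Rightarrow> 'k::field poly poly vec set.
    (\<forall>j\<in>{1..3}. openin (subtopology (zariski d) (Bal d)) (Balj j)) \<and>
    (\<Union>j\<in>{1..3}. Balj j) = Bal d \<and>
    (\<forall>j\<in>{1..3}. \<forall>g\<in>Balj j.
       hilbert_burch (d1 g) (map_mat (subst_z (lam d g)) (d2_del c j)))"
proof -
  \<comment> \<open>Column \<open>t\<close> of \<open>d2\<close>, counted from 0, is built from column \<open>t(c+1) + 1\<close> of \<open>A\<close>, and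
    \<open>p j < q j\<close> are the columns of \<open>d2\<close> that remain after the removal of column \<open>j - 1\<close>.\<close>
  define p q :: "nat \<Rightarrow> nat" where "p j = insert_index (j - 1) 0" and "q j = insert_index (j - 1) 1" for j
  define U :: "nat \<Rightarrow> 'k poly poly vec set" where
    "U j = {g \<in> Bal d. zeval (lam d g) (Aminor c (p j * (c + 1) + 1) (q j * (c + 1) + 1)) \<noteq> 0}" for j
  have "openin (subtopology (zariski d) (Bal d)) (U j)" for j
    unfolding U_def assms(1) by (rule openin_Aminor_nonzero)
  moreover have "(\<Union>j\<in>{1..3}. U j) = Bal d"
  proof (intro equalityI subsetI)
    fix g :: "'k poly poly vec" assume g: "g \<in> Bal d"
    obtain p' q' where pq: "p' < q'" "q' < 3"
        "zeval (lam d g) (Aminor c (p' * (c + 1) + 1) (q' * (c + 1) + 1)) \<noteq> 0"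
      using Bal_has_nonzero_minor g unfolding assms(1) by blast
    have "\<exists>j\<in>{1..3}. p' = p j \<and> q' = q j"
    proof -
      consider "p' = 1" "q' = 2" | "p' = 0" "q' = 2" | "p' = 0" "q' = 1"
        using pq(1,2) by linarith
      then show ?thesis
      proof cases
        case 1 then show ?thesis by (intro bexI[of _ 1]) (simp_all add: p_def q_def)
      next
        case 2 then show ?thesis by (intro bexI[of _ 2]) (simp_all add: p_def q_def)
      next
        case 3 then show ?thesis by (intro bexI[of _ 3]) (simp_all add: p_def q_def)
      qed
    qed
    then show "g \<in> (\<Union>j\<in>{1..3}. U j)" using g pq(3) by (auto simp: U_def)
  qed (auto simp: U_def)
  moreover have "hilbert_burch (d1 g) (map_mat (subst_z (lam d g)) (d2_del c j))"
    if j: "j \<in> {1..3}" and g: "g \<in> U j" for j g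
  proof -
    have "p j < q j" "q j < 3" using j by (auto simp: p_def q_def insert_index_def)
    then have "hilbert_burch (d1 g) (mat 3 2 (\<lambda>(t, l).
        form_of_coeffs c (bvec_at c g ((if l = 0 then p j else q j) * (c + 1))) t))"
      using g unfolding U_def assms(1) by (intro hilbert_burch_of_nonzero_minor) auto
    also have "mat 3 2 (\<lambda>(t, l).
        form_of_coeffs c (bvec_at c g ((if l = 0 then p j else q j) * (c + 1))) t)
      = map_mat (subst_z (lam d g)) (d2_del c j)"
      unfolding assms(1) subst_z_d2_del[OF j]
      by (rule eq_matI) (auto simp: p_def q_def less_2_cases_iff)
    finally show ?thesis .
  qed
  ultimately show ?thesis by (intro exI[of _ U]) blast
qed

end
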